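(* Let $\mathrm{d}+A$ be an $\mathfrak{sl}_2$-connection on the formal punctured disc, $A(z)=\sum_{j\in\mathbb{Z}}A_jz^{-1-j}$, and let $\psi(z)=\sum_{i\in\mathbb{Z}}\begin{pmatrix}\psi_i^+\\\psi_i^-\end{pmatrix}z^{-1-i}$. Consider $\psi(z)$ as a function with values in the dual $\mathfrak{sl}_2$-representation $\overline{\mathbb{C}^2}$, that is, let $A_j\in\mathfrak{sl}_2$ act on the column vectors $\begin{pmatrix}\psi_i^+\\\psi_i^-\end{pmatrix}$ by the matrix $-A_j^{T}$. Then, with this action, $$[L_{-1}^{\mathrm{d}+A},\psi(z)]=\left(\frac{\partial}{\partial z}+A(z)\right)\psi(z).$$
   Context: All algebras are over $\mathbb{C}$. Indices $a,b\in\{+,-\}$; $\mathbb{C}^2$ has basis $e^+,e^-$ and symplectic form $(e^+,e^-)=1=-(e^-,e^+)$, $(e^\pm,e^\pm)=0$. The $A_k\in\mathfrak{sl}_2(\mathbb{C})$ vanish for all sufficiently large $k$ (pole of finite order). Put $C_k=\begin{pmatrix}0&-1\\1&0\end{pmatrix}A_k$ (rows and columns indexed by $+,-$ in this order), a symmetric matrix with entries $C_k^{ab}$. $\mathcal{SF}_{\mathrm{d}+A}$ is the unital associative (Clifford) algebra with generators $\psi^\pm_n$, $n\in\mathbb{Z}$, and relations $\{\psi^a_m,\psi^b_n\}=m\,(e^a,e^b)\,\delta_{m+n,0}+C_{m+n}^{ab}$, where $\{x,y\}=xy+yx$. Normal ordering: $:\psi_i^a\psi_j^b:\;=\psi_i^a\psi_j^b$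 if $i<j$, $-\psi_j^b\psi_i^a$ if $i>j$, and $\frac12(\psi_i^a\psi_j^b-\psi_j^b\psi_i^a)$ if $i=j$. Set $$L_n^{\mathrm{d}+A}=\sum_{i+j=n}:\psi_i^-\psi_j^+:\;+\;c_n1,\qquad c_n=\tfrac12\sum_{i+j=n}\big(C_i^{-+}C_j^{+-}-C_i^{++}C_j^{--}\big).$$ Infinite sums are understood as operators on $\mathcal{SF}_{\mathrm{d}+A}$-modules in which every vector is annihilated by $\psi_n^\pm$ for all sufficiently large $n$; the identity is one of formal series in $z^{\pm1}$, coefficient by coefficient, and the commutator with a column vector is taken entrywise. *)

theory Defs
  imports
    "HOL-Analysis.Determinants"
    "HOL-Library.Poly_Mapping"
    "HOL-Algebra.QuotRing"
begin

section \<open>Connections\<close>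

datatype pm = Plus | Minus

lemma UNIV_pm: "UNIV = {Plus, Minus}"
  using pm.exhaust by blast

instance pm :: finite
  by standard (simp add: UNIV_pm)

definition sl2 :: "(complex^pm^pm) set" where
  "sl2 = {M. trace M = 0}"

text \<open>
  A connection \<open>d + A\<close> is given by the family of coefficients \<open>A\<^sub>k\<close> in
  \<open>A(z) = \<Sum>\<^sub>k A\<^sub>k z\<^sup>-\<^sup>1\<^sup>-\<^sup>k\<close>; that \<open>A(z)\<close> has a pole of finite order means that \<open>A\<^sub>k\<close>
  vanishes for large \<open>k\<close>.
\<close>
definition sl2_connection :: "(int \<Rightarrow> complex^pm^pm) \<Rightarrow> bool" where
  "sl2_connection A \<longleftrightarrow> (\<forall>k. A k \<in> sl2) \<and> (\<exists>N. \<forall>k\<ge>N. A k = 0)"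

fun symplectic :: "pm \<Rightarrow> pm \<Rightarrow> complex" where
  "symplectic Plus Minus = 1"
| "symplectic Minus Plus = -1"
| "symplectic Plus Plus = 0"
| "symplectic Minus Minus = 0"

text \<open>In \<open>M $ a $ b\<close> the index \<open>a\<close> is the row and \<open>b\<close> the column.\<close>
definition Jmat :: "complex^pm^pm" where
  "Jmat = (\<chi> a b. if a = Plus \<and> b = Minus then -1 else if a = Minus \<and> b = Plus then 1 else 0)"

definition Cmat :: "(int \<Rightarrow> complex^pm^pm) \<Rightarrow> int \<Rightarrow> complex^pm^pm" where
  "Cmat A k = Jmat ** A k"

section \<open>The Clifford algebra\<close>

text \<open>
  The free unital associative algebra on the symbols \<open>\<psi>\<^sup>a\<^sub>n\<close> is the monoid algebra, over the
  complex numbers, of the monoid of words in the pairs \<open>(a, n)\<close>; its product is convolution.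
\<close>
datatype psi_word = Word (letters: "(pm \<times> int) list")

instantiation psi_word :: monoid_add
begin
definition "0 = Word []"
definition "u + v = Word (letters u @ letters v)"
instance by standard (simp_all add: zero_psi_word_def plus_psi_word_def)
end

definition free_algebra :: "(psi_word \<Rightarrow>\<^sub>0 complex) ring" where
  "free_algebra = \<lparr>carrier = UNIV, mult = (*), one = 1, zero = 0, add = (+)\<rparr>"

definition free_scalar :: "complex \<Rightarrow> (psi_word \<Rightarrow>\<^sub>0 complex)" where
  "free_scalar c = Poly_Mapping.single 0 c"

definition free_psi :: "pm \<Rightarrow> int \<Rightarrow> (psi_word \<Rightarrow>\<^sub>0 complex)" where
  "free_psi a n = Poly_Mapping.single (Word [(a, n)]) 1"

definition SF_relations :: "(int \<Rightarrow> complex^pm^pm) \<Rightarrow> (psi_word \<Rightarrow>\<^sub>0 complex) set" where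
  "SF_relations A =
    {free_psi a m * free_psi b n + free_psi b n * free_psi a m
       - free_scalar (of_int m * symplectic a b * (if m + n = 0 then 1 else 0) + Cmat A (m + n) $ a $ b)
     | a b m n. True}"

definition SF_ideal :: "(int \<Rightarrow> complex^pm^pm) \<Rightarrow> (psi_word \<Rightarrow>\<^sub>0 complex) set" where
  "SF_ideal A = genideal free_algebra (SF_relations A)"

definition SF :: "(int \<Rightarrow> complex^pm^pm) \<Rightarrow> (psi_word \<Rightarrow>\<^sub>0 complex) set ring" where
  "SF A = free_algebra Quot SF_ideal A"

definition SF_class :: "(int \<Rightarrow> complex^pm^pm) \<Rightarrow> (psi_word \<Rightarrow>\<^sub>0 complex) \<Rightarrow> (psi_word \<Rightarrow>\<^sub>0 complex) set" where
  "SF_class A x = SF_ideal A +>\<^bsub>free_algebra\<^esub> x"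

text \<open>The multiple \<open>c 1\<close> of the unit; it carries the algebra structure over the complex numbers.\<close>
definition SF_scalar :: "(int \<Rightarrow> complex^pm^pm) \<Rightarrow> complex \<Rightarrow> (psi_word \<Rightarrow>\<^sub>0 complex) set" where
  "SF_scalar A c = SF_class A (free_scalar c)"

definition psi :: "(int \<Rightarrow> complex^pm^pm) \<Rightarrow> pm \<Rightarrow> int \<Rightarrow> (psi_word \<Rightarrow>\<^sub>0 complex) set" where
  "psi A a n = SF_class A (free_psi a n)"

lemma ring_free_algebra: "Ring.ring free_algebra"
  by unfold_locales
    (auto simp: free_algebra_def Units_def algebra_simps intro: exI [of _ "- x" for x]
       left_minus right_minus)

lemma ideal_SF_ideal: "ideal (SF_ideal A) free_algebra"
  unfolding SF_ideal_def
  by (rule ring.genideal_ideal [OF ring_free_algebra]) (simp add: free_algebra_def)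

lemma ring_SF: "Ring.ring (SF A)"
  unfolding SF_def by (rule ideal.quotient_is_ring [OF ideal_SF_ideal])

lemma SF_class_add: "SF_class A (x + y) = SF_class A x \<oplus>\<^bsub>SF A\<^esub> SF_class A y"
  and SF_class_mult: "SF_class A (x * y) = SF_class A x \<otimes>\<^bsub>SF A\<^esub> SF_class A y"
  and SF_class_one: "SF_class A 1 = \<one>\<^bsub>SF A\<^esub>"
  and SF_class_carrier: "SF_class A x \<in> carrier (SF A)"
proof -
  have hom: "(+>\<^bsub>free_algebra\<^esub>) (SF_ideal A) \<in> ring_hom free_algebra (SF A)"
    unfolding SF_def by (rule ideal.rcos_ring_hom [OF ideal_SF_ideal])
  show "SF_class A (x + y) = SF_class A x \<oplus>\<^bsub>SF A\<^esub> SF_class A y"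
    using ring_hom_add [OF hom, of x y] by (simp add: free_algebra_def SF_class_def)
  show "SF_class A (x * y) = SF_class A x \<otimes>\<^bsub>SF A\<^esub> SF_class A y"
    using ring_hom_mult [OF hom, of x y] by (simp add: free_algebra_def SF_class_def)
  show "SF_class A 1 = \<one>\<^bsub>SF A\<^esub>"
    using ring_hom_one [OF hom] by (simp add: free_algebra_def SF_class_def)
  show "SF_class A x \<in> carrier (SF A)"
    using ring_hom_closed [OF hom, of x] by (simp add: free_algebra_def SF_class_def)
qed

lemma psi_anticommutator:
  "psi A a m \<otimes>\<^bsub>SF A\<^esub> psi A b n \<oplus>\<^bsub>SF A\<^esub> psi A b n \<otimes>\<^bsub>SF A\<^esub> psi A a m =
     SF_scalar A (of_int m * symplectic a b * (if m + n = 0 then 1 else 0) + Cmat A (m + n) $ a $ b)"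
proof -
  let ?l = "free_psi a m * free_psi b n + free_psi b n * free_psi a m"
  let ?r = "free_scalar (of_int m * symplectic a b * (if m + n = 0 then 1 else 0) + Cmat A (m + n) $ a $ b)"
  have "?l - ?r \<in> SF_relations A"
    unfolding SF_relations_def by blast
  then have mem: "?l - ?r \<in> SF_ideal A"
    unfolding SF_ideal_def
    using ring.genideal_self [OF ring_free_algebra, of "SF_relations A"]
    by (auto simp: free_algebra_def)
  have "SF_class A (?l - ?r) = \<zero>\<^bsub>SF A\<^esub>"
    using abelian_group.a_coset_join2 [OF ring.is_abelian_group [OF ring_free_algebra],
        of "?l - ?r" "SF_ideal A"] mem
      additive_subgroup.a_subgroup [OF ideal.axioms(1) [OF ideal_SF_ideal [of A]]]
    by (simp add: SF_class_def SF_def FactRing_def free_algebra_def)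
  then have "SF_class A ?l = SF_class A ?r"
    using SF_class_add [of A "?l - ?r" ?r] SF_class_carrier [of A ?r]
      ring.ring_simprules(8) [OF ring_SF] by simp
  then show ?thesis
    by (simp add: SF_class_add SF_class_mult psi_def SF_scalar_def)
qed

definition normal_ordered ::
  "(int \<Rightarrow> complex^pm^pm) \<Rightarrow> pm \<Rightarrow> int \<Rightarrow> pm \<Rightarrow> int \<Rightarrow> (psi_word \<Rightarrow>\<^sub>0 complex) set" where
  "normal_ordered A a i b j =
    (if i < j then psi A a i \<otimes>\<^bsub>SF A\<^esub> psi A b j
     else if i > j then \<ominus>\<^bsub>SF A\<^esub> (psi A b j \<otimes>\<^bsub>SF A\<^esub> psi A a i)
     else SF_scalar A (1/2) \<otimes>\<^bsub>SF A\<^esub>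
       (psi A a i \<otimes>\<^bsub>SF A\<^esub> psi A b j \<ominus>\<^bsub>SF A\<^esub> psi A b j \<otimes>\<^bsub>SF A\<^esub> psi A a i))"

section \<open>Modules\<close>

locale SF_module = vector_space smul
  for A :: "int \<Rightarrow> complex^pm^pm"
    and smul :: "complex \<Rightarrow> 'v::ab_group_add \<Rightarrow> 'v"
    and act :: "(psi_word \<Rightarrow>\<^sub>0 complex) set \<Rightarrow> 'v \<Rightarrow> 'v" +
  assumes act_linear: "x \<in> carrier (SF A) \<Longrightarrow> Vector_Spaces.linear smul smul (act x)"
    and act_add: "x \<in> carrier (SF A) \<Longrightarrow> y \<in> carrier (SF A) \<Longrightarrow>
      act (x \<oplus>\<^bsub>SF A\<^esub> y) v = act x v + act y v"
    and act_mult: "x \<in> carrier (SF A) \<Longrightarrow> y \<in> carrier (SF A) \<Longrightarrow>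
      act (x \<otimes>\<^bsub>SF A\<^esub> y) v = act x (act y v)"
    and act_scalar: "act (SF_scalar A c) v = smul c v"

definition smooth_module ::
  "(int \<Rightarrow> complex^pm^pm) \<Rightarrow> (complex \<Rightarrow> 'v::ab_group_add \<Rightarrow> 'v)
    \<Rightarrow> ((psi_word \<Rightarrow>\<^sub>0 complex) set \<Rightarrow> 'v \<Rightarrow> 'v) \<Rightarrow> bool" where
  "smooth_module A smul act \<longleftrightarrow>
     SF_module A smul act \<and> (\<forall>v. \<exists>N. \<forall>n\<ge>N. \<forall>a. act (psi A a n) v = 0)"

text \<open>
  Below, infinite sums are \<^const>\<open>Sum_any\<close>, the sum of the nonzero terms provided there are only
  finitely many of them (and \<open>0\<close> otherwise).  The lemmas \<open>finite_support_*\<close> show that for a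
  connection and a smooth module every sum that occurs has finitely many nonzero terms.
\<close>

definition c_const :: "(int \<Rightarrow> complex^pm^pm) \<Rightarrow> int \<Rightarrow> complex" where
  "c_const A n = 1/2 * Sum_any (\<lambda>i.
      Cmat A i $ Minus $ Plus * Cmat A (n - i) $ Plus $ Minus
    - Cmat A i $ Plus $ Plus * Cmat A (n - i) $ Minus $ Minus)"

definition L_op ::
  "(int \<Rightarrow> complex^pm^pm) \<Rightarrow> ((psi_word \<Rightarrow>\<^sub>0 complex) set \<Rightarrow> 'v::ab_group_add \<Rightarrow> 'v)
    \<Rightarrow> int \<Rightarrow> 'v \<Rightarrow> 'v" where
  "L_op A act n v =
     Sum_any (\<lambda>i. act (normal_ordered A Minus i Plus (n - i)) v) + act (SF_scalar A (c_const A n)) v"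

section \<open>Formal series\<close>

text \<open>
  A formal series \<open>\<Sum>\<^sub>n f\<^sub>n z\<^sup>n\<close> is the function \<open>n \<mapsto> f\<^sub>n\<close> on the integers.  Series of column vectors
  of operators on a module with underlying space \<open>'v\<close> have type \<open>int \<Rightarrow> pm \<Rightarrow> 'v \<Rightarrow> 'v\<close>.
\<close>

text \<open>\<open>\<psi>\<^sub>i\<close> and \<open>A\<^sub>i\<close> are the coefficients of \<open>z\<^sup>-\<^sup>1\<^sup>-\<^sup>i\<close>, so the coefficient of \<open>z\<^sup>n\<close> has \<open>i = -1 - n\<close>.\<close>
definition psi_series ::
  "(int \<Rightarrow> complex^pm^pm) \<Rightarrow> ((psi_word \<Rightarrow>\<^sub>0 complex) set \<Rightarrow> 'v \<Rightarrow> 'v) \<Rightarrow> int \<Rightarrow> pm \<Rightarrow> 'v \<Rightarrow> 'v" where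
  "psi_series A act n a = act (psi A a (- 1 - n))"

definition connection_series :: "(int \<Rightarrow> complex^pm^pm) \<Rightarrow> int \<Rightarrow> complex^pm^pm" where
  "connection_series A n = A (- 1 - n)"

definition dual_rep :: "complex^pm^pm \<Rightarrow> complex^pm^pm" where
  "dual_rep M = - transpose M"

definition ddz ::
  "(complex \<Rightarrow> 'v \<Rightarrow> 'v) \<Rightarrow> (int \<Rightarrow> pm \<Rightarrow> 'v \<Rightarrow> 'v) \<Rightarrow> int \<Rightarrow> pm \<Rightarrow> 'v \<Rightarrow> 'v" where
  "ddz smul f n a v = smul (of_int (n + 1)) (f (n + 1) a v)"

definition series_apply ::
  "(complex \<Rightarrow> 'v::ab_group_add \<Rightarrow> 'v) \<Rightarrow> (int \<Rightarrow> complex^pm^pm)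
    \<Rightarrow> (int \<Rightarrow> pm \<Rightarrow> 'v \<Rightarrow> 'v) \<Rightarrow> int \<Rightarrow> pm \<Rightarrow> 'v \<Rightarrow> 'v" where
  "series_apply smul M f n a v =
     Sum_any (\<lambda>p. \<Sum>b\<in>UNIV. smul (M p $ a $ b) (f (n - p) b v))"

lemma (in SF_module) act_one: "act \<one>\<^bsub>SF A\<^esub> v = v"
  using act_scalar [of 1 v]
  by (simp add: SF_scalar_def free_scalar_def SF_class_one)

lemma (in SF_module) act_zero: "act \<zero>\<^bsub>SF A\<^esub> v = 0"
  using act_add [of "\<zero>\<^bsub>SF A\<^esub>" "\<zero>\<^bsub>SF A\<^esub>" v]
  by (simp add: ring.ring_simprules [OF ring_SF])

lemma (in SF_module) act_minus: "x \<in> carrier (SF A) \<Longrightarrow> act (\<ominus>\<^bsub>SF A\<^esub> x) v = - act x v"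
  using act_add [of x "\<ominus>\<^bsub>SF A\<^esub> x" v] act_zero [of v]
  by (simp add: ring.ring_simprules [OF ring_SF] eq_neg_iff_add_eq_0 add.commute)

lemma finite_support_c_const:
  assumes "sl2_connection A"
  shows "finite {i. Cmat A i $ Minus $ Plus * Cmat A (n - i) $ Plus $ Minus
    - Cmat A i $ Plus $ Plus * Cmat A (n - i) $ Minus $ Minus \<noteq> 0}"
proof -
  obtain N where N: "\<And>k. k \<ge> N \<Longrightarrow> A k = 0"
    using assms unfolding sl2_connection_def by blast
  have C: "Cmat A k = 0" if "k \<ge> N" for k
    using N [OF that] by (simp add: Cmat_def matrix_matrix_mult_def vec_eq_iff)
  show ?thesis
  proof (rule finite_subset)
    show "{i. Cmat A i $ Minus $ Plus * Cmat A (n - i) $ Plus $ Minus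
      - Cmat A i $ Plus $ Plus * Cmat A (n - i) $ Minus $ Minus \<noteq> 0} \<subseteq> {n - N..N}"
    proof
      fix i
      assume i: "i \<in> {i. Cmat A i $ Minus $ Plus * Cmat A (n - i) $ Plus $ Minus
        - Cmat A i $ Plus $ Plus * Cmat A (n - i) $ Minus $ Minus \<noteq> 0}"
      have "\<not> i \<ge> N" "\<not> n - i \<ge> N"
        using i C [of i] C [of "n - i"] by auto
      then show "i \<in> {n - N..N}" by simp
    qed
  qed simp
qed

lemma finite_support_L_op:
  fixes smul :: "complex \<Rightarrow> 'v::ab_group_add \<Rightarrow> 'v"
  assumes "smooth_module A smul act"
  shows "finite {i. act (normal_ordered A Minus i Plus (n - i)) v \<noteq> 0}"
proof -
  interpret SF_module A smul act
    using assms unfolding smooth_module_def by blast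
  obtain N where N: "\<And>k a. k \<ge> N \<Longrightarrow> act (psi A a k) v = 0"
    using assms unfolding smooth_module_def by blast
  have psi: "psi A a k \<in> carrier (SF A)" for a k
    by (simp add: psi_def SF_class_carrier)
  have act0: "act x 0 = 0" if "x \<in> carrier (SF A)" for x
  proof -
    have "act x (0 + 0) = act x 0 + act x 0"
      using act_linear [OF that] unfolding Vector_Spaces.linear_iff by blast
    then show ?thesis by simp
  qed
  show ?thesis
  proof (rule finite_subset)
    show "{i. act (normal_ordered A Minus i Plus (n - i)) v \<noteq> 0} \<subseteq> {min (n - N) (- \<bar>n\<bar>)..max N \<bar>n\<bar>}"
    proof (rule subsetI, rule ccontr)
      fix i
      assume "i \<in> {i. act (normal_ordered A Minus i Plus (n - i)) v \<noteq> 0}"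
        and i: "i \<notin> {min (n - N) (- \<bar>n\<bar>)..max N \<bar>n\<bar>}"
      then have ne: "act (normal_ordered A Minus i Plus (n - i)) v \<noteq> 0" by simp
      from i consider "i < n - i" "n - i \<ge> N" | "i > n - i" "i \<ge> N"
        by (auto simp: min_def max_def split: if_splits)
      then show False
      proof cases
        case 1
        then have "act (normal_ordered A Minus i Plus (n - i)) v = 0"
          by (simp add: normal_ordered_def act_mult psi N act0)
        with ne show False by simp
      next
        case 2
        then have "act (normal_ordered A Minus i Plus (n - i)) v = 0"
          by (simp add: normal_ordered_def act_mult act_minus psi N act0
              ring.ring_simprules(5) [OF ring_SF])
        with ne show False by simp
      qed
    qed
  qed simp
qed

lemma finite_support_series_apply:
  fixes smul :: "complex \<Rightarrow> 'v::ab_group_add \<Rightarrow> 'v"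
  assumes "sl2_connection A" and "smooth_module A smul act"
  shows "finite {p. (\<Sum>b\<in>UNIV. smul (dual_rep (connection_series A p) $ a $ b)
    (psi_series A act (n - p) b v)) \<noteq> 0}"
proof -
  interpret SF_module A smul act
    using assms unfolding smooth_module_def by blast
  obtain N where N: "\<And>k a. k \<ge> N \<Longrightarrow> act (psi A a k) v = 0"
    using assms unfolding smooth_module_def by blast
  obtain K where K: "\<And>k. k \<ge> K \<Longrightarrow> A k = 0"
    using assms unfolding sl2_connection_def by blast
  show ?thesis
  proof (rule finite_subset)
    show "{p. (\<Sum>b\<in>UNIV. smul (dual_rep (connection_series A p) $ a $ b)
      (psi_series A act (n - p) b v)) \<noteq> 0} \<subseteq> {- 1 - K..N + n + 1}"
    proof (rule subsetI, rule ccontr)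
      fix p
      assume ne: "p \<in> {p. (\<Sum>b\<in>UNIV. smul (dual_rep (connection_series A p) $ a $ b)
        (psi_series A act (n - p) b v)) \<noteq> 0}" and "p \<notin> {- 1 - K..N + n + 1}"
      then consider "- 1 - p \<ge> K" | "- 1 - (n - p) \<ge> N" by fastforce
      then show False
      proof cases
        case 1
        then have "dual_rep (connection_series A p) = 0"
          using K by (simp add: dual_rep_def connection_series_def transpose_def vec_eq_iff)
        with ne show False by simp
      next
        case 2
        then have "psi_series A act (n - p) b v = 0" for b
          using N by (simp add: psi_series_def)
        with ne show False by simp
      qed
    qed
  qed simp
qed

definition op_commutator :: "('v \<Rightarrow> 'v::ab_group_add) \<Rightarrow> ('v \<Rightarrow> 'v) \<Rightarrow> 'v \<Rightarrow> 'v" where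
  "op_commutator X Y v = X (Y v) - Y (X v)"

end

theory Submission
  imports Defs
begin

text \<open>
  Anticommutators of generators are scalars, so \<open>[xy, z] = x{y, z} - {x, z}y\<close> shows that
  \<open>[:\<psi>\<^sup>-\<^sub>i \<psi>\<^sup>+\<^sub>j:, \<psi>\<^sup>a\<^sub>k]\<close> is linear in \<open>\<psi>\<close>, for either order of the two factors. Summed over
  \<open>i + j = -1\<close>, the terms \<open>m (e\<^sup>a, e\<^sup>b) \<delta>\<close> give the derivative, and the terms \<open>C\<^sup>a\<^sup>b\<close> give the action
  of \<open>-A\<^sup>T\<close>.
\<close>

text \<open>The scalar to which the anticommutator of two generators is equal. The body copies the
  right-hand side of \<open>psi_anticommutator\<close>, so that after unfolding the Clifford
  relation rewrites directly.\<close>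

definition psi_bracket :: "(int \<Rightarrow> complex^pm^pm) \<Rightarrow> pm \<Rightarrow> int \<Rightarrow> pm \<Rightarrow> int \<Rightarrow> complex" where
  "psi_bracket A a m b n =
     of_int m * symplectic a b * (if m + n = 0 then 1 else 0) + Cmat A (m + n) $ a $ b"

lemma sum_pm: "(\<Sum>b\<in>UNIV. f b) = f Plus + f Minus"
  by (simp add: UNIV_pm)

lemma Cmat_nth: "Cmat A k $ a $ b = (if a = Plus then - (A k $ Minus $ b) else A k $ Plus $ b)"
  by (cases a) (simp_all add: Cmat_def Jmat_def matrix_matrix_mult_def sum_pm)

text \<open>Additivity of \<open>Sum_any\<close> applied to (f - g) + g. Finiteness matters because
  \<open>Sum_any\<close> is 0 on an infinite support.\<close>

lemma Sum_any_diff: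
  fixes f g :: "'a \<Rightarrow> 'b::ab_group_add"
  assumes "finite {x. f x \<noteq> 0}" "finite {x. g x \<noteq> 0}"
  shows "Sum_any (\<lambda>x. f x - g x) = Sum_any f - Sum_any g"
proof -
  have "finite {x. f x - g x \<noteq> 0}"
    by (rule finite_subset [OF _ finite_UnI [OF assms]]) auto
  then have "Sum_any (\<lambda>x. f x - g x + g x) = Sum_any (\<lambda>x. f x - g x) + Sum_any g"
    using assms(2) by (rule Sum_any.distrib)
  then show ?thesis by (simp add: algebra_simps)
qed

lemma Sum_any_additive:
  fixes h :: "'b::comm_monoid_add \<Rightarrow> 'c::comm_monoid_add"
  assumes "h 0 = 0" "\<And>x y. h (x + y) = h x + h y" "finite {x. f x \<noteq> 0}"
  shows "h (Sum_any f) = Sum_any (\<lambda>x. h (f x))"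
proof -
  have "h (Sum_any f) = (\<Sum>x\<in>{x. f x \<noteq> 0}. h (f x))"
    unfolding Sum_any.expand_set using assms(3)
    by (rule finite_induct) (simp_all add: assms)
  also have "\<dots> = Sum_any (\<lambda>x. h (f x))"
    \<comment> \<open>\<open>h\<close> may kill nonzero terms, so the support of \<open>f\<close> is
      only a superset of the new one.\<close>
    by (rule Sum_any.expand_superset [symmetric]) (use assms in auto)
  finally show ?thesis .
qed

lemma Sum_any_reindex_bij:
  assumes "bij g"
  shows "Sum_any (\<lambda>x. f (g x)) = Sum_any f"
  by (rule Sum_any.reindex_cong [OF assms, symmetric]) (simp add: fun_eq_iff)

context SF_module
begin

lemma psi_closed: "psi A a n \<in> carrier (SF A)"
  by (simp add: psi_def SF_class_carrier)

lemma scalar_closed: "SF_scalar A c \<in> carrier (SF A)"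
  by (simp add: SF_scalar_def SF_class_carrier)

lemma act_linear_iff:
  assumes "x \<in> carrier (SF A)"
  shows "act x (v + w) = act x v + act x w" "act x (smul c v) = smul c (act x v)"
  using act_linear [OF assms] unfolding Vector_Spaces.linear_iff by blast+

lemma act_additive:
  assumes "x \<in> carrier (SF A)"
  shows "act x 0 = 0" "act x (- v) = - act x v" "act x (v - w) = act x v - act x w"
proof -
  interpret act: Vector_Spaces.linear smul smul "act x"
    using assms by (rule act_linear)
  show "act x 0 = 0" "act x (- v) = - act x v" "act x (v - w) = act x v - act x w"
    by (simp_all add: act.zero act.neg act.diff)
qed

lemma act_psi_swap:
  "act (psi A a m) (act (psi A b n) v) =
     smul (psi_bracket A a m b n) v - act (psi A b n) (act (psi A a m) v)"
proof -
  have "act (psi A a m) (act (psi A b n) v) + act (psi A b n) (act (psi A a m) v) =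
      act (SF_scalar A (psi_bracket A a m b n)) v"
    unfolding psi_bracket_def psi_anticommutator [symmetric]
    by (simp add: act_add act_mult psi_closed ring.ring_simprules [OF ring_SF])
  then show ?thesis
    by (simp add: act_scalar eq_diff_eq)
qed

text \<open>Carrying \<open>psi A c k\<close> to the left, first across \<open>psi A b j\<close> and
  then across \<open>psi A a i\<close>, leaves one scalar behind at each swap; the cubic terms
  cancel.\<close>

lemma act_psi_psi_commutator:
  "act (psi A a i) (act (psi A b j) (act (psi A c k) v))
     - act (psi A c k) (act (psi A a i) (act (psi A b j) v)) =
   smul (psi_bracket A b j c k) (act (psi A a i) v)
     - smul (psi_bracket A a i c k) (act (psi A b j) v)"
  by (simp add: act_psi_swap [of b j c k] act_psi_swap [of a i c k "act (psi A b j) v"]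
      act_additive act_linear_iff psi_closed)

text \<open>The right-hand side changes sign when (a, i) and (b, j) are exchanged, which compensates
  the sign in the normal ordering. All three cases therefore give the same value.\<close>

lemma act_normal_ordered_commutator:
  "act (normal_ordered A a i b j) (act (psi A c k) v)
     - act (psi A c k) (act (normal_ordered A a i b j) v) =
   smul (psi_bracket A b j c k) (act (psi A a i) v)
     - smul (psi_bracket A a i c k) (act (psi A b j) v)"
  (is "?lhs = ?rhs")
proof -
  have prod: "psi A a i \<otimes>\<^bsub>SF A\<^esub> psi A b j \<in> carrier (SF A)" for a b i j
    by (simp add: psi_closed ring.ring_simprules(5) [OF ring_SF])
  note C = act_psi_psi_commutator [of a i b j c k v] act_psi_psi_commutator [of b j a i c k v]
  consider "i < j" | "i > j" | "i = j" by linarith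
  then show ?thesis
  proof cases
    case 1
    then show ?thesis
      by (simp add: normal_ordered_def act_mult psi_closed C)
  next
    case 2
    then show ?thesis
      using C(2)
      by (simp add: normal_ordered_def act_mult act_minus act_additive psi_closed prod algebra_simps)
  next
    case 3
    let ?ab = "\<lambda>w. act (psi A a i) (act (psi A b j) w)"
    let ?ba = "\<lambda>w. act (psi A b j) (act (psi A a i) w)"
    let ?c = "act (psi A c k)"
    have half: "act (normal_ordered A a i b j) w = smul (1/2) (?ab w - ?ba w)" for w
      using 3 by (simp add: normal_ordered_def a_minus_def act_mult act_add act_minus act_scalar
          psi_closed scalar_closed prod scale_right_diff_distrib ring.ring_simprules [OF ring_SF])
    have "?lhs = smul (1/2) ((?ab (?c v) - ?c (?ab v)) - (?ba (?c v) - ?c (?ba v)))"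
      by (simp add: half act_additive act_linear_iff psi_closed scale_right_diff_distrib)
    \<comment> \<open>By this antisymmetry the second commutator is \<open>- ?rhs\<close>, so the
      difference is twice \<open>?rhs\<close>.\<close>
    also have "\<dots> = smul (1/2) (?rhs + ?rhs)"
      by (simp add: C)
    also have "\<dots> = ?rhs"
      by (simp flip: scale_left_distrib add: scale_right_distrib)
    finally show ?thesis .
  qed
qed

end

theorem corollary4p5:
  fixes A :: "int \<Rightarrow> complex^pm^pm"
    and smul :: "complex \<Rightarrow> 'v::ab_group_add \<Rightarrow> 'v"
    and act :: "(psi_word \<Rightarrow>\<^sub>0 complex) set \<Rightarrow> 'v \<Rightarrow> 'v"
  assumes "sl2_connection A"
    and "smooth_module A smul act"
  shows "\<forall>n a v. op_commutator (L_op A act (- 1)) (psi_series A act n a) v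
    = ddz smul (psi_series A act) n a v
      + series_apply smul (\<lambda>k. dual_rep (connection_series A k)) (psi_series A act) n a v"
proof (intro allI)
  fix n :: int and a :: pm and v :: 'v
  interpret SF_module A smul act
    using assms(2) unfolding smooth_module_def by blast
  \<comment> \<open>The coefficient of z^n in the series is the mode of index
    \<open>k\<close>.\<close>
  define k where "k = - 1 - n"
  let ?P = "\<lambda>b i. act (psi A b i)"
  let ?T = "\<lambda>i. act (normal_ordered A Minus i Plus (- 1 - i))"
  \<comment> \<open>Both families are indexed by the mode that survives the bracket. The i-th
    commutator is thus \<open>D i - E (- 1 - i)\<close>, and reflecting the index aligns the two
    sums.\<close>
  define D where "D i = smul (psi_bracket A Plus (- 1 - i) a k) (?P Minus i v)" for i
  define E where "E i = smul (psi_bracket A Minus (- 1 - i) a k) (?P Plus i v)" for i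
  define R where "R p = (\<Sum>b\<in>UNIV. smul (dual_rep (connection_series A p) $ a $ b)
    (psi_series A act (n - p) b v))" for p
  \<comment> \<open>The delta in the bracket requires (- 1 - i) + k = 0, that is i = k - 1, and its
    factor m = - 1 - i is then - k = n + 1.\<close>
  define S where "S i = (if i = k - 1 then smul (of_int (n + 1)) (?P a i v) else 0)" for i
  note fin_T = finite_support_L_op [OF assms(2), of "- 1"]
  have fin_PT: "finite {i. ?P a k (?T i v) \<noteq> 0}"
    by (rule finite_subset [OF _ fin_T [of v]]) (auto simp: act_additive psi_closed)
  obtain N where N: "\<And>m b. m \<ge> N \<Longrightarrow> ?P b m v = 0"
    using assms(2) unfolding smooth_module_def by blast
  obtain K where K: "\<And>m. m \<ge> K \<Longrightarrow> A m = 0"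
    using assms(1) unfolding sl2_connection_def by blast
  \<comment> \<open>Below k - 1 the delta vanishes; below k - K the index - 1 - i + k is at least K,
    where \<open>A\<close> vanishes. Smoothness bounds the supports of \<open>D\<close> and
    \<open>E\<close> from above.\<close>
  have bracket_0: "psi_bracket A b (- 1 - i) a k = 0" if "i < min (k - 1) (k - K)" for b i
    using that K [of "- 1 - i + k"] by (simp add: psi_bracket_def Cmat_nth)
  have fin_DE: "finite {i. D i \<noteq> 0}" "finite {i. E i \<noteq> 0}"
  proof -
    have "D i = 0" "E i = 0" if "i \<notin> {min (k - 1) (k - K)..N}" for i
    proof -
      from that consider "i < min (k - 1) (k - K)" | "i \<ge> N" by fastforce
      then show "D i = 0" "E i = 0"
        by (cases; simp add: D_def E_def bracket_0 N)+
    qed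
    then have "{i. D i \<noteq> 0} \<subseteq> {min (k - 1) (k - K)..N}"
      and "{i. E i \<noteq> 0} \<subseteq> {min (k - 1) (k - K)..N}"
      by blast+
    then show "finite {i. D i \<noteq> 0}" "finite {i. E i \<noteq> 0}"
      by (simp_all add: finite_subset)
  qed
  have "bij (\<lambda>i::int. - 1 - i)"
    by (rule bij_betw_byWitness [where f' = "\<lambda>i. - 1 - i"]) auto
  note flip = Sum_any_reindex_bij [OF this]
  \<comment> \<open>With p = i - k the factor \<open>psi_series A act (n - p)\<close> is the mode of
    index i, as in \<open>D\<close> and \<open>E\<close>.\<close>
  have "bij (\<lambda>i::int. i - k)"
    by (rule bij_betw_byWitness [where f' = "\<lambda>i. i + k"]) auto
  note shift = Sum_any_reindex_bij [OF this]
  have fin_E': "finite {i. E (- 1 - i) \<noteq> 0}"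
    using finite_imageI [OF fin_DE(2), of "\<lambda>i. - 1 - i"]
    by (rule finite_subset [rotated]) (auto intro!: image_eqI [of _ _ "- 1 - _"])
  have fin_R: "finite {i. R (i - k) \<noteq> 0}"
    using finite_imageI [OF finite_support_series_apply [OF assms], of "\<lambda>p. p + k" a n v]
    by (rule finite_subset [rotated]) (auto simp: R_def intro!: image_eqI [of _ _ "_ - k"])
  \<comment> \<open>The scalar term of \<open>L_op\<close> commutes with the linear operator
    \<open>?P a k\<close> and cancels.\<close>
  have "op_commutator (L_op A act (- 1)) (psi_series A act n a) v
      = Sum_any (\<lambda>i. ?T i (?P a k v)) - ?P a k (Sum_any (\<lambda>i. ?T i v))"
    by (simp add: op_commutator_def L_op_def psi_series_def k_def act_scalar act_linear_iff
        psi_closed)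
  also have "\<dots> = Sum_any (\<lambda>i. ?T i (?P a k v)) - Sum_any (\<lambda>i. ?P a k (?T i v))"
    by (subst Sum_any_additive [where h = "?P a k"])
      (use fin_T in \<open>simp_all add: act_additive act_linear_iff psi_closed\<close>)
  also have "\<dots> = Sum_any (\<lambda>i. ?T i (?P a k v) - ?P a k (?T i v))"
    by (rule Sum_any_diff [symmetric, OF fin_T fin_PT])
  also have "\<dots> = Sum_any (\<lambda>i. D i - E (- 1 - i))"
    by (simp add: act_normal_ordered_commutator D_def E_def)
  also have "\<dots> = Sum_any D - Sum_any E"
    by (simp add: Sum_any_diff [OF fin_DE(1) fin_E'] flip)
  also have "\<dots> = Sum_any (\<lambda>i. D i - E i)"
    by (rule Sum_any_diff [symmetric, OF fin_DE])
  also have "\<dots> = Sum_any (\<lambda>i. S i + R (i - k))"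
  proof (rule arg_cong [of _ _ Sum_any], rule ext)
    fix i
    have idx: "- 1 - (i - k) = k - 1 - i" "- 1 - (n - (i - k)) = i" "- 1 - i + k = k - 1 - i"
      by (simp_all add: k_def)
    have *: "D i = smul (psi_bracket A Plus (- 1 - i) a k) (?P Minus i v)"
      "E i = smul (psi_bracket A Minus (- 1 - i) a k) (?P Plus i v)"
      "R (i - k) = - smul (A (k - 1 - i) $ Plus $ a) (?P Plus i v)
         - smul (A (k - 1 - i) $ Minus $ a) (?P Minus i v)"
      "psi_bracket A b (- 1 - i) a k = (if i = k - 1 then of_int (- k) * symplectic b a else 0)
         + Cmat A (k - 1 - i) $ b $ a" for b
      unfolding D_def E_def R_def psi_bracket_def connection_series_def psi_series_def idx
      by (auto simp: sum_pm dual_rep_def transpose_def)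
    \<comment> \<open>The delta contributes only to the term whose mode has sign \<open>a\<close>:
      to \<open>D\<close> for \<open>Minus\<close>, to \<open>E\<close> for \<open>Plus\<close>,
      where \<open>symplectic Minus Plus = -1\<close> absorbs the minus sign. The rows exchanged by
      \<open>Jmat\<close> produce the entries of the negative transpose.\<close>
    show "D i - E i = S i + R (i - k)"
      unfolding * S_def
      by (cases a) (auto simp: Cmat_nth scale_left_distrib scale_left_diff_distrib k_def)
  qed
  also have "\<dots> = Sum_any S + Sum_any R"
  proof -
    have "finite {i. S i \<noteq> 0}"
      by (rule finite_subset [of _ "{k - 1}"]) (auto simp: S_def)
    then show ?thesis
      by (simp add: Sum_any.distrib fin_R shift)
  qed
  also have "Sum_any S = ddz smul (psi_series A act) n a v"
  proof -
    have "Sum_any S = sum S {k - 1}"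
      by (rule Sum_any.expand_superset) (auto simp: S_def)
    then show ?thesis
      by (simp add: S_def ddz_def psi_series_def k_def algebra_simps)
  qed
  also have "Sum_any R
      = series_apply smul (\<lambda>k. dual_rep (connection_series A k)) (psi_series A act) n a v"
    by (simp add: R_def series_apply_def)
  finally show "op_commutator (L_op A act (- 1)) (psi_series A act n a) v
    = ddz smul (psi_series A act) n a v
      + series_apply smul (\<lambda>k. dual_rep (connection_series A k)) (psi_series A act) n a v" .
qed

end
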